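(* Let $L_p(x)$ denote the Legendre polynomial of degree $p$. Then for every integer $p\ge2$ and every real $x$, $$\begin{aligned}L_{p+2}(x)={}&\frac{(2p-1)(2p+1)(2p+3)x^2-(2p-1)(p+1)^2-p^2(2p+3)}{(2p-1)(p+1)(p+2)}L_p(x)\\&-\frac{p(p-1)(2p+3)}{(2p-1)(p+1)(p+2)}L_{p-2}(x),\end{aligned}$$ with initial values $L_0(x)=1$, $L_1(x)=x$, $L_2(x)=\frac12(3x^2-1)$ and $L_3(x)=\frac12(5x^3-3x)$.
   Context: The Legendre polynomials are $L_p(x)=\frac{1}{2^pp!}\frac{d^p}{dx^p}(x^2-1)^p$. Equivalently, $L_0(x)=1$, $L_1(x)=x$ and $L_{p+1}(x)=\frac{2p+1}{p+1}xL_p(x)-\frac{p}{p+1}L_{p-1}(x)$ for $p\ge1$. *)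

theory Defs
  imports "HOL-Analysis.Analysis" "HOL-Computational_Algebra.Polynomial"
begin

definition legendre :: "nat \<Rightarrow> real poly" where
  "legendre p = smult (1 / (2 ^ p * fact p)) ((pderiv ^^ p) ((monom 1 2 - 1) ^ p))"

lemma deriv_funpow_poly: "(deriv ^^ n) (poly q) = poly ((pderiv ^^ n) q)"
  for q :: "real poly"
proof (induction n)
  case (Suc n)
  have "deriv (poly r) = poly (pderiv r)" for r :: "real poly"
    by (rule ext, rule DERIV_imp_deriv, rule poly_DERIV)
  with Suc show ?case by simp
qed simp

text \<open>The formal derivative above agrees with the analytic derivative in Rodrigues' formula.\<close>

lemma poly_legendre_Rodrigues:
  "poly (legendre p) x = 1 / (2 ^ p * fact p) * (deriv ^^ p) (\<lambda>t. (t ^ 2 - 1) ^ p) x"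
proof -
  have "(\<lambda>t::real. (t ^ 2 - 1) ^ p) = poly ((monom 1 2 - 1) ^ p)"
    by (rule ext) (simp add: poly_monom)
  then show ?thesis
    by (simp only: deriv_funpow_poly legendre_def poly_smult)
qed

end

theory Submission
  imports Defs
begin

text \<open>
  The step from \<open>L\<^sub>p\<^sub>-\<^sub>2\<close>, \<open>L\<^sub>p\<close> to \<open>L\<^sub>p\<^sub>+\<^sub>2\<close> comes from Bonnet's three-term recurrence
  \<open>(n + 1) L\<^sub>n\<^sub>+\<^sub>1 = (2 n + 1) x L\<^sub>n - n L\<^sub>n\<^sub>-\<^sub>1\<close> (\<open>legendre_Bonnet\<close>) by elimination. Taken at \<open>n = p + 1\<close> and \<open>n = p\<close>,
  the recurrence expresses \<open>L\<^sub>p\<^sub>+\<^sub>2\<close> through \<open>L\<^sub>p\<close> and \<open>x L\<^sub>p\<^sub>-\<^sub>1\<close>; taken at \<open>n = p - 1\<close>, it expresses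
  \<open>x L\<^sub>p\<^sub>-\<^sub>1\<close> through \<open>L\<^sub>p\<close> and \<open>L\<^sub>p\<^sub>-\<^sub>2\<close>.

  Bonnet's recurrence comes from Rodrigues' formula by computing \<open>D\<^sup>n\<^sup>+\<^sup>1 q\<^sup>n\<^sup>+\<^sup>1\<close>, where
  \<open>q = x\<^sup>2 - 1\<close>, in two ways. One differentiation gives \<open>D q\<^sup>n\<^sup>+\<^sup>1 = 2 (n + 1) x q\<^sup>n\<close>, and the
  remaining \<open>n\<close> are distributed by Leibniz' rule. Two differentiations, with \<open>x\<^sup>2\<close> replaced by
  \<open>q + 1\<close>, give a combination of \<open>q\<^sup>n\<close> and \<open>q\<^sup>n\<^sup>-\<^sup>1\<close> with constant coefficients. Both results
  contain \<open>D\<^sup>n\<^sup>-\<^sup>1 q\<^sup>n\<close>, which is not a multiple of a Legendre polynomial; eliminating it leaves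
  the recurrence.
\<close>

lemma higher_pderiv_X_mult:
  "(pderiv ^^ Suc n) ([:0, 1:] * q) =
    [:0, 1:] * (pderiv ^^ Suc n) q + smult (of_nat (Suc n)) ((pderiv ^^ n) q)"
proof (induction n)
  case 0
  show ?case by (simp add: pderiv_mult pderiv_pCons add.commute)
next
  case (Suc n)
  have "(pderiv ^^ Suc (Suc n)) ([:0, 1:] * q) = pderiv ((pderiv ^^ Suc n) ([:0, 1:] * q))"
    by simp
  also have "\<dots> = [:0, 1:] * (pderiv ^^ Suc (Suc n)) q
      + smult (of_nat (Suc (Suc n))) ((pderiv ^^ Suc n) q)"
    unfolding Suc.IH
    by (simp add: pderiv_add pderiv_mult pderiv_smult pderiv_pCons smult_add_left add_ac)
  finally show ?case .
qed

text \<open>The polynomials of Rodrigues' formula without their normalization.\<close>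

definition rodrigues :: "nat \<Rightarrow> real poly" where
  "rodrigues n = (pderiv ^^ n) ((monom 1 2 - 1) ^ n)"

lemma poly_legendre_rodrigues:
  "poly (legendre n) x = poly (rodrigues n) x / (2 ^ n * fact n)"
  by (simp add: legendre_def rodrigues_def)

lemma pderiv_power_Suc_quadratic:
  "pderiv ((monom 1 2 - 1) ^ Suc n) =
    smult (2 * real (Suc n)) ([:0, 1:] * (monom 1 2 - 1) ^ n)"
proof -
  have "pderiv (monom 1 2 - 1 :: real poly) = smult 2 [:0, 1:]"
    by (simp add: pderiv_diff pderiv_monom pderiv_pCons monom_Suc numeral_2_eq_2 monom_0)
  then show ?thesis
    unfolding pderiv_power_Suc by (simp add: mult.commute)
qed

lemma pderiv_pderiv_power_quadratic:
  "pderiv (pderiv ((monom 1 2 - 1) ^ Suc (Suc n))) =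
    smult (2 * real (Suc (Suc n)))
      (smult (2 * real n + 3) ((monom 1 2 - 1) ^ Suc n)
        + smult (2 * real (Suc n)) ((monom 1 2 - 1) ^ n))"
proof -
  let ?q = "monom 1 2 - 1 :: real poly"
  have X2: "[:0, 1:] * ([:0, 1:] * r) = ?q * r + r" for r :: "real poly"
    by (simp add: monom_Suc numeral_2_eq_2 monom_0 algebra_simps)
  have "pderiv ([:0, 1:] * ?q ^ Suc n) =
      ?q ^ Suc n + [:0, 1:] * smult (2 * real (Suc n)) ([:0, 1:] * ?q ^ n)"
    by (simp only: pderiv_mult pderiv_power_Suc_quadratic) (simp add: pderiv_pCons)
  also have "\<dots> = ?q ^ Suc n + smult (2 * real (Suc n)) (?q ^ Suc n + ?q ^ n)"
    by (simp only: mult_smult_right X2 power_Suc)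
  also have "\<dots> = smult (2 * real n + 3) (?q ^ Suc n) + smult (2 * real (Suc n)) (?q ^ n)"
    by (rule poly_eqI) (simp add: algebra_simps)
  finally show ?thesis
    by (simp only: pderiv_power_Suc_quadratic pderiv_smult)
qed

lemma poly_rodrigues_recurrence:
  "poly (rodrigues (Suc (Suc n))) x =
    2 * (2 * real n + 3) * x * poly (rodrigues (Suc n)) x
      - 4 * (real n + 1) ^ 2 * poly (rodrigues n) x"
proof -
  let ?q = "monom 1 2 - 1 :: real poly"
  define a where "a = poly (rodrigues (Suc (Suc n))) x"
  define b where "b = poly ((pderiv ^^ n) (?q ^ Suc n)) x"
  have "rodrigues (Suc (Suc n)) =
      (pderiv ^^ Suc n) (pderiv (?q ^ Suc (Suc n)))"
    unfolding rodrigues_def by (subst funpow_Suc_right) simp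
  then have 1: "a = 2 * (real n + 2) * (x * poly (rodrigues (Suc n)) x + (real n + 1) * b)"
    unfolding a_def b_def
    by (simp only: pderiv_power_Suc_quadratic higher_pderiv_smult higher_pderiv_X_mult)
      (simp add: rodrigues_def algebra_simps)
  have "rodrigues (Suc (Suc n)) = (pderiv ^^ n) (pderiv (pderiv (?q ^ Suc (Suc n))))"
    unfolding rodrigues_def by (simp only: funpow_Suc_right o_apply)
  then have 2: "a = 2 * (real n + 2) *
      ((2 * real n + 3) * b + 2 * (real n + 1) * poly (rodrigues n) x)"
    unfolding a_def b_def
    by (simp only: pderiv_pderiv_power_quadratic higher_pderiv_smult higher_pderiv_add)
      (simp add: rodrigues_def algebra_simps)
  \<comment> \<open>Multiplying by the coefficient of \<open>b\<close> in the other equation makes \<open>b\<close> cancel; the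
    coefficient of \<open>a\<close> in the difference is \<open>(2 n + 3) - (n + 1)\<close>.\<close>
  have "(2 * real n + 3) * a - (real n + 1) * a =
      (2 * real n + 3) * (2 * (real n + 2) * (x * poly (rodrigues (Suc n)) x + (real n + 1) * b))
      - (real n + 1) * (2 * (real n + 2) *
          ((2 * real n + 3) * b + 2 * (real n + 1) * poly (rodrigues n) x))"
    using 1 2 by simp
  then have "(real n + 2) * a = (real n + 2) *
      (2 * (2 * real n + 3) * x * poly (rodrigues (Suc n)) x
        - 4 * (real n + 1) ^ 2 * poly (rodrigues n) x)"
    by (simp add: algebra_simps power2_eq_square)
  moreover have "real n + 2 \<noteq> 0"
    by linarith
  ultimately show ?thesis
    unfolding a_def by (metis mult_left_cancel)
qed

lemma legendre_Bonnet:
  "(real n + 2) * poly (legendre (Suc (Suc n))) x =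
    (2 * real n + 3) * x * poly (legendre (Suc n)) x - (real n + 1) * poly (legendre n) x"
proof -
  have R: "poly (rodrigues k) x = 2 ^ k * fact k * poly (legendre k) x" for k
    by (simp add: poly_legendre_rodrigues)
  \<comment> \<open>The factor that the terms of the recurrence share once the normalizations \<open>2 ^ k * fact k\<close>
    are written out.\<close>
  define c :: real where "c = 4 * (real n + 1) * 2 ^ n * fact n"
  have "c * ((real n + 2) * poly (legendre (Suc (Suc n))) x) =
      c * ((2 * real n + 3) * x * poly (legendre (Suc n)) x - (real n + 1) * poly (legendre n) x)"
    using poly_rodrigues_recurrence[of n x] unfolding R c_def
    by (simp add: algebra_simps power2_eq_square)
  moreover have "c \<noteq> 0"
    unfolding c_def by (simp add: add_nonneg_eq_0_iff)
  ultimately show ?thesis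
    by (metis mult_left_cancel)
qed

lemma poly_legendre_0: "poly (legendre 0) x = 1"
  by (simp add: legendre_def)

lemma poly_legendre_1: "poly (legendre 1) x = x"
  using pderiv_power_Suc_quadratic[of 0] by (simp add: legendre_def)

lemma poly_legendre_2: "poly (legendre 2) x = 1 / 2 * (3 * x ^ 2 - 1)"
  using legendre_Bonnet[of 0 x] poly_legendre_0[of x] poly_legendre_1[of x]
  by (simp add: numeral_2_eq_2 field_simps)

lemma poly_legendre_3: "poly (legendre 3) x = 1 / 2 * (5 * x ^ 3 - 3 * x)"
proof -
  have "3 * poly (legendre 3) x = 5 * x * poly (legendre 2) x - 2 * poly (legendre 1) x"
    using legendre_Bonnet[of 1 x] by (simp add: numeral_2_eq_2 numeral_3_eq_3)
  then show ?thesis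
    unfolding poly_legendre_2 poly_legendre_1
    by (simp add: field_simps power2_eq_square power3_eq_cube)
qed

lemma legendre_step_two:
  fixes p :: nat and x :: real
  assumes "p \<ge> 2"
  shows "poly (legendre (p + 2)) x =
    ((2 * real p - 1) * (2 * real p + 1) * (2 * real p + 3) * x ^ 2
        - (2 * real p - 1) * (real p + 1) ^ 2 - real p ^ 2 * (2 * real p + 3))
      / ((2 * real p - 1) * (real p + 1) * (real p + 2)) * poly (legendre p) x
    - (real p * (real p - 1) * (2 * real p + 3))
      / ((2 * real p - 1) * (real p + 1) * (real p + 2)) * poly (legendre (p - 2)) x"
proof -
  define r where "r = real p"
  define a where "a = poly (legendre (p - 2)) x"
  define b where "b = poly (legendre (p - 1)) x"
  define c where "c = poly (legendre p) x"
  define d where "d = poly (legendre (p + 1)) x"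
  define e where "e = poly (legendre (p + 2)) x"
  obtain m where m: "p = Suc (Suc m)"
    using assms by (metis add_2_eq_Suc le_Suc_ex)
  have r: "r \<ge> 2"
    using assms by (simp add: r_def)
  have 1: "r * c = (2 * r - 1) * x * b - (r - 1) * a"
    using legendre_Bonnet[of m x] by (simp add: m r_def a_def b_def c_def algebra_simps)
  have 2: "(r + 1) * d = (2 * r + 1) * x * c - r * b"
    using legendre_Bonnet[of "Suc m" x] by (simp add: m r_def b_def c_def d_def algebra_simps)
  have 3: "(r + 2) * e = (2 * r + 3) * x * d - (r + 1) * c"
    using legendre_Bonnet[of "Suc (Suc m)" x]
    by (simp add: m r_def c_def d_def e_def algebra_simps)
  have "(2 * r - 1) * (r + 1) * (r + 2) * e = (2 * r - 1) * (r + 1) * ((r + 2) * e)"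
    by simp
  also have "\<dots> = (2 * r - 1) * ((2 * r + 3) * x * ((r + 1) * d) - (r + 1)\<^sup>2 * c)"
    unfolding 3 by (simp add: algebra_simps power2_eq_square)
  also have "\<dots> = (2 * r - 1) * (2 * r + 1) * (2 * r + 3) * x\<^sup>2 * c - (2 * r - 1) * (r + 1)\<^sup>2 * c
      - r * (2 * r + 3) * ((2 * r - 1) * x * b)"
    unfolding 2 by (simp add: algebra_simps power2_eq_square)
  also have "(2 * r - 1) * x * b = r * c + (r - 1) * a"
    using 1 by simp
  finally have "(2 * r - 1) * (r + 1) * (r + 2) * e =
      ((2 * r - 1) * (2 * r + 1) * (2 * r + 3) * x\<^sup>2 - (2 * r - 1) * (r + 1)\<^sup>2
        - r\<^sup>2 * (2 * r + 3)) * c - r * (r - 1) * (2 * r + 3) * a"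
    by (simp add: algebra_simps power2_eq_square)
  moreover have "(2 * r - 1) * (r + 1) * (r + 2) \<noteq> 0"
    using r by simp
  ultimately have "e =
      (((2 * r - 1) * (2 * r + 1) * (2 * r + 3) * x\<^sup>2 - (2 * r - 1) * (r + 1)\<^sup>2
        - r\<^sup>2 * (2 * r + 3)) * c - r * (r - 1) * (2 * r + 3) * a)
      / ((2 * r - 1) * (r + 1) * (r + 2))"
    by (metis nonzero_mult_div_cancel_left)
  then show ?thesis
    unfolding r_def a_def c_def e_def
    by (simp only: times_divide_eq_left flip: diff_divide_distrib)
qed

theorem mainTheorem7:
  shows "(\<forall>p::nat. \<forall>x::real. p \<ge> 2 \<longrightarrow>
      poly (legendre (p + 2)) x =
        ((2 * real p - 1) * (2 * real p + 1) * (2 * real p + 3) * x ^ 2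
            - (2 * real p - 1) * (real p + 1) ^ 2 - real p ^ 2 * (2 * real p + 3))
          / ((2 * real p - 1) * (real p + 1) * (real p + 2)) * poly (legendre p) x
        - (real p * (real p - 1) * (2 * real p + 3))
          / ((2 * real p - 1) * (real p + 1) * (real p + 2)) * poly (legendre (p - 2)) x)
    \<and> (\<forall>x::real. poly (legendre 0) x = 1)
    \<and> (\<forall>x::real. poly (legendre 1) x = x)
    \<and> (\<forall>x::real. poly (legendre 2) x = 1 / 2 * (3 * x ^ 2 - 1))
    \<and> (\<forall>x::real. poly (legendre 3) x = 1 / 2 * (5 * x ^ 3 - 3 * x))"
  using legendre_step_two poly_legendre_0 poly_legendre_1 poly_legendre_2 poly_legendre_3
  by blast

end
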